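(* Let $n\ge 3$ be an integer and let $g=([n],E)$ be a hypergraph with $[n]\in E$. Then no $n$-qubit graph state is LU equivalent to the hypergraph state $|g\rangle$; that is, for every simple undirected graph $h$ with vertex set $[n]$, there are no $2\times2$ unitary matrices $U_1,\dots,U_n$ such that $|g\rangle=(U_1\otimes U_2\otimes\cdots\otimes U_n)|h\rangle$.
   Context: For a positive integer $n$, $[n]=\{1,2,\dots,n\}$. A hypergraph is a pair $(V,E)$ with $V$ a finite set of vertices and $E\subseteq\wp(V)$ (the power set of $V$) a set of hyperedges; the empty hyperedge $\varnothing$ and one-element hyperedges are allowed. The $n$-qubit hypergraph state of $g=([n],E)$ is the unit vector in $(\mathbb{C}^2)^{\otimes n}$ $$|g\rangle=\frac{1}{\sqrt{2^n}}\sum_{x\in\{0,1\}^n}(-1)^{u(g)(x)}|x_1\rangle\otimes\cdots\otimes|x_n\rangle,\qquad u(g)(x_1,\dots,x_n)=\bigoplus_{e\in E}\ \prod_{k\in e}x_k,$$ where $\oplus$ is addition modulo 2 and the empty product equals $1$. A simple undirected graph on $[n]$ is regarded as a hypergraph $h=([n],F)$ all of whose hyperedges have cardinality exactly $2$; its graph state is the hypergraph state $|h\rangle$. *)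

theory Defs
  imports "Jordan_Normal_Form.Schur_Decomposition"
begin

definition hypergraph :: "'a set \<Rightarrow> 'a set set \<Rightarrow> bool" where
  "hypergraph V E \<longleftrightarrow> finite V \<and> E \<subseteq> Pow V"

definition simple_graph :: "'a set \<Rightarrow> 'a set set \<Rightarrow> bool" where
  "simple_graph V F \<longleftrightarrow> hypergraph V F \<and> (\<forall>e\<in>F. card e = 2)"

text \<open>Kronecker products: the tensor product of coordinate spaces of dimensions \<open>m\<close> and \<open>d\<close>
  is the coordinate space of dimension \<open>m * d\<close>, the basis vector number \<open>a * d + b\<close> being the
  tensor product of the basis vectors number \<open>a\<close> and \<open>b\<close>.\<close>

definition kron_vec :: "'a::comm_ring_1 vec \<Rightarrow> 'a vec \<Rightarrow> 'a vec" where
  "kron_vec v w = vec (dim_vec v * dim_vec w)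
     (\<lambda>i. v $ (i div dim_vec w) * w $ (i mod dim_vec w))"

definition kron_mat :: "'a::comm_ring_1 mat \<Rightarrow> 'a mat \<Rightarrow> 'a mat" where
  "kron_mat A B = mat (dim_row A * dim_row B) (dim_col A * dim_col B)
     (\<lambda>(i, j). A $$ (i div dim_row B, j div dim_col B) * B $$ (i mod dim_row B, j mod dim_col B))"

text \<open>\<open>tensor_vecs v n\<close> is the product of \<open>v 1, \<dots>, v n\<close>, in this order; likewise for matrices.\<close>

primrec tensor_vecs :: "(nat \<Rightarrow> 'a::comm_ring_1 vec) \<Rightarrow> nat \<Rightarrow> 'a vec" where
  "tensor_vecs v 0 = vec 1 (\<lambda>_. 1)"
| "tensor_vecs v (Suc n) = kron_vec (tensor_vecs v n) (v (Suc n))"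

primrec tensor_mats :: "(nat \<Rightarrow> 'a::comm_ring_1 mat) \<Rightarrow> nat \<Rightarrow> 'a mat" where
  "tensor_mats U 0 = 1\<^sub>m 1"
| "tensor_mats U (Suc n) = kron_mat (tensor_mats U n) (U (Suc n))"

definition bit_strings :: "nat \<Rightarrow> (nat \<Rightarrow> nat) set" where
  "bit_strings n = {1..n} \<rightarrow>\<^sub>E {0, 1}"

definition hypergraph_fun :: "nat set set \<Rightarrow> (nat \<Rightarrow> nat) \<Rightarrow> nat" where
  "hypergraph_fun E x = (\<Sum>e\<in>E. \<Prod>k\<in>e. x k) mod 2"

definition hypergraph_state :: "nat \<Rightarrow> nat set set \<Rightarrow> complex vec" where
  "hypergraph_state n E =
     complex_of_real (1 / sqrt (2 ^ n)) \<cdot>\<^sub>v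
       finsum_vec TYPE(complex) (2 ^ n)
         (\<lambda>x. (- 1) ^ hypergraph_fun E x \<cdot>\<^sub>v tensor_vecs (\<lambda>k. unit_vec 2 (x k)) n)
         (bit_strings n)"

definition unitary_mat :: "nat \<Rightarrow> complex mat \<Rightarrow> bool" where
  "unitary_mat d U \<longleftrightarrow> U \<in> carrier_mat d d \<and>
     inverts_mat U (mat_adjoint U) \<and> inverts_mat (mat_adjoint U) U"

definition LU_equivalent :: "nat \<Rightarrow> complex vec \<Rightarrow> complex vec \<Rightarrow> bool" where
  "LU_equivalent n \<psi> \<phi> \<longleftrightarrow>
     (\<exists>U. (\<forall>k\<in>{1..n}. unitary_mat 2 (U k)) \<and> \<psi> = tensor_mats U n *\<^sub>v \<phi>)"

end

(* Reshape a state of m + 1 qubits into a 2^m x 2 matrix M, the columns being indexed by the last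
   qubit.  A local unitary turns M into A * M * U^T with A and U unitary, so the Gram determinant
   det (M^* M), i.e. the determinant of the reduced state of the last qubit, is an LU invariant.
   For a hypergraph state it equals (4^m - S^2) / 4^(m+1), where S is the sum of
   (-1)^(u(y,0) + u(y,1)) over all bit strings y of length m, and S = 2^m - 2 W with W congruent
   modulo 2 to the number of ones of u.  Since the monomial of an edge e has 2^(n - |e|) ones,
   that number is odd iff [n] is an edge.  As m >= 2, 4 divides 2^m, so 4 divides S iff [n] is
   not an edge; hence S^2 differs for g and for a graph. *)
theory Submission
  imports Defs
begin

section \<open>Kronecker products and adjoints\<close>

text \<open>Division with remainder identifies \<open>{0..<p * q}\<close> with a p by q grid. Sums
  over a Kronecker index thereby become double sums.\<close>

lemma sum_div_mod:
  fixes f :: "nat \<Rightarrow> nat \<Rightarrow> 'a::comm_monoid_add"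
  assumes "q > 0"
  shows "(\<Sum>i = 0..<p * q. f (i div q) (i mod q)) = (\<Sum>a = 0..<p. \<Sum>b = 0..<q. f a b)"
  unfolding sum.cartesian_product
proof (rule sum.reindex_bij_witness[where i = "\<lambda>(a, b). a * q + b" and j = "\<lambda>i. (i div q, i mod q)"])
  fix ab assume "ab \<in> {0..<p} \<times> {0..<q}"
  then obtain a b where ab: "ab = (a, b)" "a < p" "b < q" by auto
  have "a * q + b < Suc a * q" using ab by simp
  also have "\<dots> \<le> p * q" using ab by (intro mult_right_mono) auto
  finally show "(case ab of (a, b) \<Rightarrow> a * q + b) \<in> {0..<p * q}" using ab by simp
qed (use assms in \<open>auto simp: less_mult_imp_div_less\<close>)

lemma div_mod_less_mult:
  assumes "(i::nat) < p * q"
  shows "i div q < p" "i mod q < q"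
  using assms by (auto simp: less_mult_imp_div_less intro!: mod_less_divisor gr0I)

lemma dim_mat_adjoint [simp]:
  "dim_row (mat_adjoint A) = dim_col A" "dim_col (mat_adjoint A) = dim_row A"
  by (auto simp: mat_adjoint_def)

lemma index_mat_adjoint [simp]:
  assumes "i < dim_col A" "j < dim_row A"
  shows "mat_adjoint A $$ (i, j) = conjugate (A $$ (j, i))"
  using assms by (simp add: mat_adjoint_def mat_of_rows_def)

lemma mat_adjoint_carrier [intro]:
  "A \<in> carrier_mat p q \<Longrightarrow> mat_adjoint A \<in> carrier_mat q p"
  by auto

lemma mat_adjoint_mult:
  fixes A B :: "complex mat"
  assumes "dim_col A = dim_row B"
  shows "mat_adjoint (A * B) = mat_adjoint B * mat_adjoint A"
  by (rule eq_matI) (use assms in \<open>auto simp: scalar_prod_def mult.commute\<close>)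

lemma dim_kron_mat [simp]:
  "dim_row (kron_mat A B) = dim_row A * dim_row B" "dim_col (kron_mat A B) = dim_col A * dim_col B"
  by (auto simp: kron_mat_def)

lemma index_kron_mat:
  assumes "i < dim_row A * dim_row B" "j < dim_col A * dim_col B"
  shows "kron_mat A B $$ (i, j) =
    A $$ (i div dim_row B, j div dim_col B) * B $$ (i mod dim_row B, j mod dim_col B)"
  using assms by (simp add: kron_mat_def)

text \<open>The mixed-product rule: once the summation index of an entry is split into quotient and
  remainder, the double sum factors.\<close>

lemma kron_mat_mult:
  assumes "dim_col A = dim_row C" "dim_col B = dim_row D" "dim_row D > 0"
  shows "kron_mat A B * kron_mat C D = kron_mat (A * C) (B * D)"
proof (rule eq_matI)
  fix i j assume "i < dim_row (kron_mat (A * C) (B * D))" "j < dim_col (kron_mat (A * C) (B * D))"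
  then have ij: "i < dim_row A * dim_row B" "j < dim_col C * dim_col D" by auto
  note b = div_mod_less_mult[OF ij(1)] div_mod_less_mult[OF ij(2)]
  let ?f = "\<lambda>a b. (A $$ (i div dim_row B, a) * B $$ (i mod dim_row B, b)) *
      (C $$ (a, j div dim_col D) * D $$ (b, j mod dim_col D))"
  have "(kron_mat A B * kron_mat C D) $$ (i, j) =
      (\<Sum>k = 0..<dim_row C * dim_row D. ?f (k div dim_row D) (k mod dim_row D))"
    using ij assms by (simp add: scalar_prod_def index_kron_mat)
  also have "\<dots> = (\<Sum>a = 0..<dim_row C. \<Sum>b = 0..<dim_row D. ?f a b)"
    by (rule sum_div_mod) fact
  also have "\<dots> = (A * C) $$ (i div dim_row B, j div dim_col D) *
      (B * D) $$ (i mod dim_row B, j mod dim_col D)"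
    using b assms by (simp add: scalar_prod_def sum_product ac_simps)
  also have "\<dots> = kron_mat (A * C) (B * D) $$ (i, j)"
    using ij by (simp add: index_kron_mat)
  finally show "(kron_mat A B * kron_mat C D) $$ (i, j) = kron_mat (A * C) (B * D) $$ (i, j)" .
qed auto

lemma mat_adjoint_kron:
  fixes A B :: "complex mat"
  shows "mat_adjoint (kron_mat A B) = kron_mat (mat_adjoint A) (mat_adjoint B)"
  by (rule eq_matI) (auto simp: index_kron_mat div_mod_less_mult)

lemma kron_mat_one: "kron_mat (1\<^sub>m p) (1\<^sub>m q) = 1\<^sub>m (p * q)"
proof (rule eq_matI)
  fix i j assume "i < dim_row (1\<^sub>m (p * q))" "j < dim_col (1\<^sub>m (p * q))"
  then have ij: "i < p * q" "j < p * q" by auto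
  have "i = j \<longleftrightarrow> i div q = j div q \<and> i mod q = j mod q"
    by (metis div_mult_mod_eq)
  then show "kron_mat (1\<^sub>m p) (1\<^sub>m q) $$ (i, j) = 1\<^sub>m (p * q) $$ (i, j)"
    using ij div_mod_less_mult[OF ij(1)] div_mod_less_mult[OF ij(2)] by (auto simp: index_kron_mat)
qed auto

section \<open>Tensor products of local unitaries\<close>

lemma tensor_mats_carrier:
  assumes "\<forall>k\<in>{1..n}. U k \<in> carrier_mat d d"
  shows "tensor_mats U n \<in> carrier_mat (d ^ n) (d ^ n)"
  using assms
proof (induction n)
  case (Suc n)
  then have "U (Suc n) \<in> carrier_mat d d" "tensor_mats U n \<in> carrier_mat (d ^ n) (d ^ n)" by auto
  then show ?case by (auto simp: mult.commute)
qed simp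

lemma tensor_mats_isometry:
  assumes "\<forall>k\<in>{1..n}. unitary_mat d (U k)" "d > 0"
  shows "mat_adjoint (tensor_mats U n) * tensor_mats U n = 1\<^sub>m (d ^ n)"
  using assms
proof (induction n)
  case 0
  show ?case by (rule eq_matI) (auto simp: scalar_prod_def)
next
  case (Suc n)
  have A: "tensor_mats U n \<in> carrier_mat (d ^ n) (d ^ n)"
    using Suc.prems by (intro tensor_mats_carrier) (auto simp: unitary_mat_def)
  have U: "U (Suc n) \<in> carrier_mat d d" "mat_adjoint (U (Suc n)) * U (Suc n) = 1\<^sub>m d"
    using Suc.prems by (auto simp: unitary_mat_def inverts_mat_def)
  have "mat_adjoint (tensor_mats U (Suc n)) * tensor_mats U (Suc n) =
      kron_mat (mat_adjoint (tensor_mats U n) * tensor_mats U n) (mat_adjoint (U (Suc n)) * U (Suc n))"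
    using A U(1) Suc.prems by (simp add: mat_adjoint_kron kron_mat_mult)
  then show ?case using Suc U(2) by (simp add: kron_mat_one mult.commute)
qed

section \<open>The Gram determinant of the last qubit\<close>

text \<open>The index \<open>i * 2 + a\<close> follows the numbering of \<open>kron_vec\<close>,
  where the last qubit is the least significant digit.\<close>

definition split_last :: "nat \<Rightarrow> 'a vec \<Rightarrow> 'a mat" where
  "split_last p v = mat p 2 (\<lambda>(i, a). v $ (i * 2 + a))"

text \<open>The Gram matrix of the two columns is the transpose of the reduced density matrix of the
  last qubit, so the determinants agree.\<close>

definition last_gram_det :: "nat \<Rightarrow> complex vec \<Rightarrow> complex" where
  "last_gram_det p v = det (mat_adjoint (split_last p v) * split_last p v)"

lemma split_last_carrier [simp]: "split_last p v \<in> carrier_mat p 2"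
  by (simp add: split_last_def)

text \<open>The vectorization identity in row-major order: the second Kronecker factor acts on the
  column index and so appears transposed on the right.\<close>

lemma split_last_kron:
  fixes v :: "complex vec"
  assumes A: "A \<in> carrier_mat p p" and U: "U \<in> carrier_mat 2 2" and v: "v \<in> carrier_vec (p * 2)"
  shows "split_last p (kron_mat A U *\<^sub>v v) = A * (split_last p v * transpose_mat U)"
proof (rule eq_matI)
  fix i a assume "i < dim_row (A * (split_last p v * transpose_mat U))"
    "a < dim_col (A * (split_last p v * transpose_mat U))"
  then have i: "i < p" and a: "a < 2" using A U by auto
  have ia: "i * 2 + a < p * 2" using i a by simp
  have dm: "(i * 2 + a) div 2 = i" "(i * 2 + a) mod 2 = a" using a by auto
  let ?f = "\<lambda>k b. A $$ (i, k) * U $$ (a, b) * v $ (k * 2 + b)"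
  have "split_last p (kron_mat A U *\<^sub>v v) $$ (i, a) =
      (\<Sum>j = 0..<p * 2. A $$ (i, j div 2) * U $$ (a, j mod 2) * v $ j)"
    using A U v i a ia dm by (simp add: split_last_def scalar_prod_def index_kron_mat)
  \<comment> \<open>Here \<open>j\<close> is recomposed from its quotient and remainder by 2, the
    shape that \<open>sum_div_mod\<close> expects.\<close>
  also have "\<dots> = (\<Sum>j = 0..<p * 2. ?f (j div 2) (j mod 2))" by simp
  also have "\<dots> = (\<Sum>k = 0..<p. \<Sum>b = 0..<2. ?f k b)" by (rule sum_div_mod) simp
  also have "\<dots> = (A * (split_last p v * transpose_mat U)) $$ (i, a)"
    using A U i a by (simp add: scalar_prod_def split_last_def sum_distrib_left ac_simps)
  finally show "split_last p (kron_mat A U *\<^sub>v v) $$ (i, a) =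
      (A * (split_last p v * transpose_mat U)) $$ (i, a)" .
qed (use A U in \<open>auto simp: split_last_def\<close>)

text \<open>The new Gram matrix is T^* M^* M T with T = U^T, since A cancels by A^* A = 1. The
  determinants of T^* and T multiply to 1.\<close>

lemma last_gram_det_unitary:
  assumes A: "A \<in> carrier_mat p p" and AA: "mat_adjoint A * A = 1\<^sub>m p"
    and U: "unitary_mat 2 U" and v: "v \<in> carrier_vec (p * 2)"
  shows "last_gram_det p (kron_mat A U *\<^sub>v v) = last_gram_det p v"
proof -
  have Uc: "U \<in> carrier_mat 2 2" and UU: "U * mat_adjoint U = 1\<^sub>m 2"
    using U by (auto simp: unitary_mat_def inverts_mat_def)
  define M T where "M = split_last p v" and "T = transpose_mat U"
  have c: "M \<in> carrier_mat p 2" "T \<in> carrier_mat 2 2" "mat_adjoint M \<in> carrier_mat 2 p"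
      "mat_adjoint T \<in> carrier_mat 2 2" "mat_adjoint A \<in> carrier_mat p p"
    using Uc A by (auto simp: M_def T_def)
  have MM: "mat_adjoint M * M \<in> carrier_mat 2 2" "mat_adjoint M * M * T \<in> carrier_mat 2 2"
    using c by (blast intro: mult_carrier_mat)+
  have MT: "mat_adjoint (M * T) \<in> carrier_mat 2 p"
    by (rule mat_adjoint_carrier[OF mult_carrier_mat[OF c(1,2)]])
  \<comment> \<open>T^* is the entrywise conjugate of U; through this identity the equation U U^* =
    1 enters.\<close>
  have "mat_adjoint T * T = transpose_mat (U * mat_adjoint U)"
    by (rule eq_matI) (use Uc in \<open>auto simp: T_def scalar_prod_def mult.commute\<close>)
  then have TT: "mat_adjoint T * T = 1\<^sub>m 2" using UU by simp
  have "mat_adjoint (A * (M * T)) * (A * (M * T)) =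
      mat_adjoint (M * T) * (mat_adjoint A * (A * (M * T)))"
    using A c MT by (simp add: mat_adjoint_mult[of A "M * T"] assoc_mult_mat[of _ 2 p _ p _ 2])
  also have "mat_adjoint A * (A * (M * T)) = M * T"
    using A c AA by (simp flip: assoc_mult_mat[of _ p p _ p _ 2])
  also have "mat_adjoint (M * T) * (M * T) = mat_adjoint T * ((mat_adjoint M * M) * T)"
    using c by (simp add: mat_adjoint_mult assoc_mult_mat[of _ 2 2 _ p _ 2] assoc_mult_mat[of _ 2 p _ 2 _ 2])
  finally have "det (mat_adjoint (A * (M * T)) * (A * (M * T))) =
      det (mat_adjoint T) * (det (mat_adjoint M * M) * det T)"
    using c MM by (simp add: det_mult[of _ 2] del: assoc_mult_mat)
  also have "\<dots> = det (mat_adjoint M * M) * det (mat_adjoint T * T)"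
    using c by (simp add: det_mult[of _ 2])
  finally show ?thesis
    unfolding last_gram_det_def split_last_kron[OF A Uc v] by (simp add: M_def T_def TT[unfolded T_def])
qed

lemma last_gram_det_LU:
  assumes "LU_equivalent (Suc m) \<psi> \<phi>" "\<phi> \<in> carrier_vec (2 ^ Suc m)"
  shows "last_gram_det (2 ^ m) \<psi> = last_gram_det (2 ^ m) \<phi>"
proof -
  obtain U where U: "\<forall>k\<in>{1..Suc m}. unitary_mat 2 (U k)" and \<psi>: "\<psi> = tensor_mats U (Suc m) *\<^sub>v \<phi>"
    using assms(1) by (auto simp: LU_equivalent_def)
  show ?thesis unfolding \<psi> tensor_mats.simps
    by (rule last_gram_det_unitary)
       (use U assms(2) in \<open>auto simp: mult.commute unitary_mat_def
          intro!: tensor_mats_carrier tensor_mats_isometry\<close>)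
qed

lemma det_2x2:
  fixes A :: "'a::comm_ring_1 mat"
  assumes "A \<in> carrier_mat 2 2"
  shows "det A = A $$ (0, 0) * A $$ (1, 1) - A $$ (0, 1) * A $$ (1, 0)"
proof -
  have "det A = (\<Sum>j<2. A $$ (0, j) * cofactor A 0 j)"
    using assms by (intro laplace_expansion_row) auto
  then show ?thesis
    using assms by (simp add: cofactor_def numeral_2_eq_2 det_single mat_delete_def)
qed

section \<open>Amplitudes of hypergraph states\<close>

text \<open>Horner's scheme with \<open>x 1\<close> as the most significant bit, in agreement with
  the order of the factors in \<open>tensor_vecs\<close>.\<close>

primrec bits_index :: "nat \<Rightarrow> (nat \<Rightarrow> nat) \<Rightarrow> nat" where
  "bits_index 0 x = 0"
| "bits_index (Suc n) x = bits_index n x * 2 + x (Suc n)"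

lemma bit_stringsD: "x \<in> bit_strings n \<Longrightarrow> \<forall>k\<in>{1..n}. x k < 2"
  by (fastforce simp: bit_strings_def PiE_def Pi_def)

lemma finite_bit_strings [simp]: "finite (bit_strings n)"
  by (simp add: bit_strings_def finite_PiE)

lemma card_bit_strings: "card (bit_strings n) = 2 ^ n"
  by (simp add: bit_strings_def card_PiE numeral_2_eq_2)

lemma bits_index_less: "\<forall>k\<in>{1..n}. x k < 2 \<Longrightarrow> bits_index n x < 2 ^ n"
proof (induction n)
  case (Suc n)
  then have "bits_index n x < 2 ^ n" "x (Suc n) < 2" by auto
  then show ?case by simp
qed simp

lemma bits_index_inj:
  assumes "\<forall>k\<in>{1..n}. x k < 2" "\<forall>k\<in>{1..n}. y k < 2" "bits_index n x = bits_index n y" "k \<in> {1..n}"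
  shows "x k = y k"
  using assms
proof (induction n)
  case (Suc n)
  have "x (Suc n) < 2" "y (Suc n) < 2" using Suc.prems by auto
  moreover have "bits_index n x * 2 + x (Suc n) = bits_index n y * 2 + y (Suc n)"
    using Suc.prems by simp
  ultimately have "bits_index n x = bits_index n y" "x (Suc n) = y (Suc n)" by presburger+
  then show ?case using Suc by (cases "k = Suc n") auto
qed simp

text \<open>Binary digits are unique, and both sets have 2^n elements, so injectivity
  suffices.\<close>

lemma bij_betw_bits_index: "bij_betw (bits_index n) (bit_strings n) {0..<2 ^ n}"
proof -
  have inj: "inj_on (bits_index n) (bit_strings n)"
  proof (rule inj_onI)
    fix x y assume xy: "x \<in> bit_strings n" "y \<in> bit_strings n" "bits_index n x = bits_index n y"
    show "x = y"
      by (rule PiE_ext[OF xy(1,2)[unfolded bit_strings_def]])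
         (rule bits_index_inj[OF bit_stringsD[OF xy(1)] bit_stringsD[OF xy(2)] xy(3)])
  qed
  have "bits_index n ` bit_strings n = {0..<2 ^ n}"
    by (rule card_subset_eq)
       (auto simp: card_image[OF inj] card_bit_strings bits_index_less[OF bit_stringsD])
  then show ?thesis using inj by (simp add: bij_betw_def)
qed

lemma bits_index_cong: "(\<And>k. k \<in> {1..n} \<Longrightarrow> x k = y k) \<Longrightarrow> bits_index n x = bits_index n y"
  by (induction n) auto

text \<open>By induction: a new factor on the right appends a last binary digit to the number of the
  basis vector.\<close>

lemma tensor_unit_vecs:
  assumes "\<forall>k\<in>{1..n}. x k < 2"
  shows "tensor_vecs (\<lambda>k. unit_vec 2 (x k)) n = (unit_vec (2 ^ n) (bits_index n x) :: 'a::comm_ring_1 vec)"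
  using assms
proof (induction n)
  case 0
  show ?case by (rule eq_vecI) auto
next
  case (Suc n)
  then have IH: "tensor_vecs (\<lambda>k. unit_vec 2 (x k)) n = (unit_vec (2 ^ n) (bits_index n x) :: 'a vec)"
    and b: "x (Suc n) < 2" by auto
  show ?case
  proof (rule eq_vecI)
    fix i assume "i < dim_vec (unit_vec (2 ^ Suc n) (bits_index (Suc n) x) :: 'a vec)"
    then have i: "i < 2 ^ n * 2" by (simp add: mult.commute)
    have "i div 2 = bits_index n x \<and> i mod 2 = x (Suc n) \<longleftrightarrow> i = bits_index n x * 2 + x (Suc n)"
      using b by presburger
    moreover have "tensor_vecs (\<lambda>k. unit_vec 2 (x k)) (Suc n) $ i =
        (if i div 2 = bits_index n x \<and> i mod 2 = x (Suc n) then 1 else 0 :: 'a)"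
      using i b div_mod_less_mult[OF i] bits_index_less[of n x] Suc.prems
      by (simp add: IH kron_vec_def)
    ultimately show "tensor_vecs (\<lambda>k. unit_vec 2 (x k)) (Suc n) $ i =
        (unit_vec (2 ^ Suc n) (bits_index (Suc n) x) :: 'a vec) $ i"
      using i bits_index_less[OF Suc.prems] by (simp add: mult.commute[of 2])
  qed (simp add: IH kron_vec_def)
qed

lemma hypergraph_state_carrier [simp]: "hypergraph_state n E \<in> carrier_vec (2 ^ n)"
  unfolding hypergraph_state_def
  by (auto simp: tensor_unit_vecs[OF bit_stringsD] intro!: finsum_vec_closed)

text \<open>Distinct bit strings number distinct basis vectors, so a single summand contributes to
  each coordinate.\<close>

lemma hypergraph_state_index:
  assumes x: "x \<in> bit_strings n"
  shows "hypergraph_state n E $ bits_index n x =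
    complex_of_real (1 / sqrt (2 ^ n)) * (- 1) ^ hypergraph_fun E x"
proof -
  have i: "bits_index n x < 2 ^ n" using x by (intro bits_index_less bit_stringsD)
  let ?v = "\<lambda>z. (- 1) ^ hypergraph_fun E z \<cdot>\<^sub>v tensor_vecs (\<lambda>k. unit_vec 2 (z k)) n :: complex vec"
  have v: "?v \<in> bit_strings n \<rightarrow> carrier_vec (2 ^ n)"
    by (auto simp: tensor_unit_vecs[OF bit_stringsD])
  have inj: "bits_index n x = bits_index n z \<longleftrightarrow> x = z" if "z \<in> bit_strings n" for z
    using bij_betw_bits_index[of n] x that by (auto simp: bij_betw_def inj_on_def)
  have "finsum_vec TYPE(complex) (2 ^ n) ?v (bit_strings n) $ bits_index n x =
      (\<Sum>z\<in>bit_strings n. ?v z $ bits_index n x)"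
    by (rule index_finsum_vec) (use i v in auto)
  also have "\<dots> = (\<Sum>z\<in>bit_strings n. if x = z then (- 1) ^ hypergraph_fun E z else 0)"
    using i inj by (intro sum.cong) (auto simp: tensor_unit_vecs[OF bit_stringsD] bits_index_less[OF bit_stringsD])
  also have "\<dots> = (- 1) ^ hypergraph_fun E x" using x by simp
  finally have "finsum_vec TYPE(complex) (2 ^ n) ?v (bit_strings n) $ bits_index n x =
    (- 1) ^ hypergraph_fun E x" .
  moreover have "finsum_vec TYPE(complex) (2 ^ n) ?v (bit_strings n) \<in> carrier_vec (2 ^ n)"
    by (rule finsum_vec_closed[OF v])
  ultimately show ?thesis using i by (simp add: hypergraph_state_def)
qed

section \<open>The coherence of the last qubit\<close>

text \<open>Up to the factor 1 / 2^(m+1), this is the off-diagonal entry of the reduced state of the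
  last qubit. It is kept as an integer so that divisibility by 4 can be asked.\<close>

definition last_coherence :: "nat \<Rightarrow> nat set set \<Rightarrow> int" where
  "last_coherence m E = (\<Sum>y\<in>bit_strings m.
     (- 1) ^ (hypergraph_fun E (y(Suc m := 0)) + hypergraph_fun E (y(Suc m := 1))))"

lemma bit_strings_Suc: "y \<in> bit_strings m \<Longrightarrow> a < 2 \<Longrightarrow> y(Suc m := a) \<in> bit_strings (Suc m)"
  by (auto simp: bit_strings_def PiE_iff extensional_def less_2_cases_iff)

text \<open>The amplitudes are real, so the Gram matrix is symmetric: 1/2 on the diagonal, the
  coherence over 2^(m+1) off it.\<close>

lemma last_gram_det_hypergraph_state:
  "last_gram_det (2 ^ m) (hypergraph_state (Suc m) E) =
     of_int (4 ^ m - (last_coherence m E)\<^sup>2) / 4 ^ Suc m"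
proof -
  define M where "M = split_last (2 ^ m) (hypergraph_state (Suc m) E)"
  let ?u = "\<lambda>y a. hypergraph_fun E (y(Suc m := a))"
  have amp: "M $$ (bits_index m y, a) = complex_of_real (1 / sqrt (2 ^ Suc m)) * (- 1) ^ ?u y a"
    if "y \<in> bit_strings m" "a < 2" for y a
  proof -
    \<comment> \<open>Changing bit m + 1 leaves the number of the first m bits alone, so row and
      column recombine to the index of the extended string.\<close>
    have "bits_index m y = bits_index m (y(Suc m := a))" by (rule bits_index_cong) simp
    moreover have "bits_index m y < 2 ^ m" using that(1) by (intro bits_index_less bit_stringsD)
    ultimately show ?thesis
      using that hypergraph_state_index[OF bit_strings_Suc[OF that], of E]
      by (simp add: M_def split_last_def)
  qed
  have sq: "complex_of_real (1 / sqrt (2 ^ Suc m)) * complex_of_real (1 / sqrt (2 ^ Suc m)) = 1 / 2 ^ Suc m"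
    unfolding of_real_mult[symmetric] by simp
  have M: "M \<in> carrier_mat (2 ^ m) 2" by (simp add: M_def)
  have G: "(mat_adjoint M * M) $$ (a, b) =
      of_int (\<Sum>y\<in>bit_strings m. (- 1) ^ (?u y a + ?u y b)) / 2 ^ Suc m" if ab: "a < 2" "b < 2" for a b
  proof -
    have "(mat_adjoint M * M) $$ (a, b) = (\<Sum>i = 0..<2 ^ m. cnj (M $$ (i, a)) * M $$ (i, b))"
      using M ab by (simp add: scalar_prod_def)
    also have "\<dots> = (\<Sum>y\<in>bit_strings m. cnj (M $$ (bits_index m y, a)) * M $$ (bits_index m y, b))"
      by (rule sum.reindex_bij_betw[OF bij_betw_bits_index, symmetric])
    also have "\<dots> = (\<Sum>y\<in>bit_strings m.
        (complex_of_real (1 / sqrt (2 ^ Suc m)) * complex_of_real (1 / sqrt (2 ^ Suc m))) *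
        (- 1) ^ (?u y a + ?u y b))"
      by (rule sum.cong[OF refl], simp only: amp ab) (simp add: power_add)
    also have "\<dots> = of_int (\<Sum>y\<in>bit_strings m. (- 1) ^ (?u y a + ?u y b)) / 2 ^ Suc m"
      unfolding sq by (simp add: sum_divide_distrib)
    finally show ?thesis .
  qed
  \<comment> \<open>On the diagonal each sign is squared, so the sum merely counts the 2^m
    strings.\<close>
  have "(- 1) ^ (k + k) = (1 :: int)" for k :: nat by simp
  then have diag: "(mat_adjoint M * M) $$ (a, a) = 2 ^ m / 2 ^ Suc m" if "a < 2" for a
    using G[OF that that] by (simp add: card_bit_strings del: power_Suc)
  have off: "(mat_adjoint M * M) $$ (0, 1) = of_int (last_coherence m E) / 2 ^ Suc m"
      "(mat_adjoint M * M) $$ (1, 0) = of_int (last_coherence m E) / 2 ^ Suc m"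
    using G[of 0 1] G[of 1 0] by (simp_all add: last_coherence_def add.commute)
  have pw: "(4::complex) ^ k = 2 ^ k * 2 ^ k" for k
    by (simp flip: power_mult_distrib)
  have "last_gram_det (2 ^ m) (hypergraph_state (Suc m) E) = det (mat_adjoint M * M)"
    by (simp add: last_gram_det_def M_def)
  also have "\<dots> = (2 ^ m / 2 ^ Suc m) * (2 ^ m / 2 ^ Suc m) -
      (of_int (last_coherence m E) / 2 ^ Suc m) * (of_int (last_coherence m E) / 2 ^ Suc m)"
    using M by (subst det_2x2) (auto simp only: diag off, auto)
  also have "\<dots> = of_int (4 ^ m - (last_coherence m E)\<^sup>2) / 4 ^ Suc m"
    unfolding pw[of "Suc m"]
    by (simp only: times_divide_times_eq diff_divide_distrib[symmetric] of_int_diff of_int_mult of_int_power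
        of_int_numeral pw[of m] power2_eq_square)
  finally show ?thesis .
qed

section \<open>Parity of the number of ones and divisibility of the coherence by 4\<close>

lemma even_sum_monomial_iff:
  assumes "e \<subseteq> {1..n}"
  shows "even (\<Sum>x\<in>bit_strings n. \<Prod>k\<in>e. x k) \<longleftrightarrow> e \<noteq> {1..n}"
proof -
  \<comment> \<open>Factors 1 outside \<open>e\<close> extend the monomial to all coordinates, so
    that the sum over bit strings becomes a product of sums over single bits.\<close>
  have "(\<Sum>x\<in>bit_strings n. \<Prod>k\<in>e. x k) =
      (\<Sum>x\<in>bit_strings n. \<Prod>k\<in>{1..n}. if k \<in> e then x k else 1)"
    using assms by (simp add: prod.If_cases Int_absorb1)
  also have "\<dots> = (\<Prod>k\<in>{1..n}. \<Sum>b\<in>{0, 1}. if k \<in> e then b else 1)"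
    unfolding bit_strings_def by (rule prod_sum_PiE[symmetric]) auto
  \<comment> \<open>A coordinate in \<open>e\<close> contributes 0 + 1, any other coordinate 1 +
    1.\<close>
  also have "\<dots> = (\<Prod>k\<in>{1..n}. if k \<in> e then 1 else 2)"
    by (intro prod.cong) auto
  also have "\<dots> = 2 ^ card ({1..n} - e)"
    by (simp add: prod.If_cases Diff_eq)
  finally show ?thesis using assms by auto
qed

text \<open>Reducing modulo 2 at each string does not change the parity of the total. After
  exchanging the sums, only the full edge contributes an odd amount.\<close>

lemma even_weight_iff:
  assumes "hypergraph {1..n} E"
  shows "even (\<Sum>x\<in>bit_strings n. hypergraph_fun E x) \<longleftrightarrow> {1..n} \<notin> E"
proof -
  have E: "finite E" "E \<subseteq> Pow {1..n}"
    using assms finite_subset[of E "Pow {1..n}"] by (auto simp: hypergraph_def)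
  have "even (\<Sum>x\<in>bit_strings n. hypergraph_fun E x) \<longleftrightarrow>
      even (\<Sum>x\<in>bit_strings n. \<Sum>e\<in>E. \<Prod>k\<in>e. x k)"
    by (simp add: hypergraph_fun_def even_iff_mod_2_eq_zero mod_sum_eq)
  also have "(\<Sum>x\<in>bit_strings n. \<Sum>e\<in>E. \<Prod>k\<in>e. x k) = (\<Sum>e\<in>E. \<Sum>x\<in>bit_strings n. \<Prod>k\<in>e. x k)"
    by (rule sum.swap)
  \<comment> \<open>A finite sum is even iff it has an even number of odd terms; here there is at
    most one.\<close>
  also have "even \<dots> \<longleftrightarrow> even (card {e \<in> E. odd (\<Sum>x\<in>bit_strings n. \<Prod>k\<in>e. x k)})"
    by (rule even_sum_iff) (use E in auto)
  also have "{e \<in> E. odd (\<Sum>x\<in>bit_strings n. \<Prod>k\<in>e. x k)} = (if {1..n} \<in> E then {{1..n}} else {})"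
    using E(2) even_sum_monomial_iff[of _ n] by auto
  finally show ?thesis by auto
qed

lemma sum_bit_strings_Suc:
  fixes f :: "(nat \<Rightarrow> nat) \<Rightarrow> 'a::comm_monoid_add"
  shows "(\<Sum>x\<in>bit_strings (Suc m). f x) = (\<Sum>y\<in>bit_strings m. f (y(Suc m := 0)) + f (y(Suc m := 1)))"
proof -
  have I: "{1..Suc m} = insert (Suc m) {1..m}" by auto
  have "(\<Sum>x\<in>bit_strings (Suc m). f x) =
      (\<Sum>(b, y)\<in>{0, 1} \<times> bit_strings m. f (y(Suc m := b)))"
    unfolding bit_strings_def I PiE_insert_eq
    by (subst sum.reindex) (auto intro!: inj_combinator sum.cong)
  also have "\<dots> = (\<Sum>b\<in>{0, 1}. \<Sum>y\<in>bit_strings m. f (y(Suc m := b)))"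
    by (rule sum.cartesian_product[symmetric])
  also have "\<dots> = (\<Sum>y\<in>bit_strings m. f (y(Suc m := 0)) + f (y(Suc m := 1)))"
    by (simp add: sum.distrib)
  finally show ?thesis .
qed

lemma four_dvd_last_coherence_iff:
  assumes "hypergraph {1..Suc m} E" "m \<ge> 2"
  shows "4 dvd last_coherence m E \<longleftrightarrow> {1..Suc m} \<notin> E"
proof -
  let ?s = "\<lambda>y. hypergraph_fun E (y(Suc m := 0)) + hypergraph_fun E (y(Suc m := 1))"
  \<comment> \<open>\<open>W\<close> counts the strings at which flipping the last bit changes the
    value, that is, the terms equal to -1.\<close>
  define W where "W = (\<Sum>y\<in>bit_strings m. ?s y mod 2)"
  have sgn: "(- 1) ^ k = 1 - 2 * int (k mod 2)" for k :: nat
    by (cases "even k") (auto simp: odd_iff_mod_2_eq_one)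
  have "last_coherence m E = (\<Sum>y\<in>bit_strings m. 1 - 2 * int (?s y mod 2))"
    unfolding last_coherence_def by (simp only: sgn)
  also have "\<dots> = 2 ^ m - 2 * int W"
    by (simp add: sum_subtractf card_bit_strings W_def sum_distrib_left del: of_nat_mod)
  finally have S: "last_coherence m E = 2 ^ m - 2 * int W" .
  \<comment> \<open>The parity of \<open>W\<close> survives dropping the inner reduction modulo 2;
    what remains is the sum of the hypergraph function over all strings of length m + 1.\<close>
  have "even W \<longleftrightarrow> even (\<Sum>y\<in>bit_strings m. ?s y)"
    by (simp add: W_def even_iff_mod_2_eq_zero mod_sum_eq)
  then have W: "even W \<longleftrightarrow> {1..Suc m} \<notin> E"
    using even_weight_iff[OF assms(1)] by (simp add: sum_bit_strings_Suc)
  \<comment> \<open>With 2^m vanishing modulo 4, the question is whether 4 divides 2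
    \<open>W\<close>.\<close>
  have "(4::int) dvd 2 ^ m" using le_imp_power_dvd[OF assms(2), of "2::int"] by simp
  then have "4 dvd last_coherence m E \<longleftrightarrow> even W"
    unfolding S by presburger
  then show ?thesis using W by simp
qed

theorem mainTheorem2:
  fixes n :: nat and E :: "nat set set"
  assumes "n \<ge> 3"
    and "hypergraph {1..n} E"
    and "{1..n} \<in> E"
  shows "\<not> (\<exists>F. simple_graph {1..n} F \<and>
           LU_equivalent n (hypergraph_state n E) (hypergraph_state n F))"
proof
  assume "\<exists>F. simple_graph {1..n} F \<and>
    LU_equivalent n (hypergraph_state n E) (hypergraph_state n F)"
  then obtain F where F: "simple_graph {1..n} F"
    and LU: "LU_equivalent n (hypergraph_state n E) (hypergraph_state n F)" by blast
  obtain m where n: "n = Suc m" and m: "m \<ge> 2" using assms(1) by (cases n) auto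
  \<comment> \<open>The full vertex set has at least 3 elements, whereas graph edges have 2.\<close>
  have hF: "hypergraph {1..n} F" and nF: "{1..n} \<notin> F"
    using F assms(1) by (auto simp: simple_graph_def)
  have "of_int (4 ^ m - (last_coherence m E)\<^sup>2) / 4 ^ Suc m =
      (of_int (4 ^ m - (last_coherence m F)\<^sup>2) / 4 ^ Suc m :: complex)"
    using last_gram_det_LU[OF LU[unfolded n]] by (simp only: last_gram_det_hypergraph_state hypergraph_state_carrier)
  then have "(of_int (4 ^ m - (last_coherence m E)\<^sup>2) :: complex) =
      of_int (4 ^ m - (last_coherence m F)\<^sup>2)"
    by (simp only: divide_cancel_right) simp
  then have "(last_coherence m E)\<^sup>2 = (last_coherence m F)\<^sup>2"
    unfolding of_int_eq_iff by simp
  \<comment> \<open>Equal squares leave the two integers equal up to sign, which divisibility by 4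
    does not see.\<close>
  then have "4 dvd last_coherence m E \<longleftrightarrow> 4 dvd last_coherence m F"
    by (auto simp: power2_eq_iff)
  then show False
    using four_dvd_last_coherence_iff[of m] assms hF nF m n by auto
qed

end
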